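(* There exists a holomorphic function $\phi$ from the open unit disk $\mathbb{D}$ onto $\mathbb{D}$ (that is, $\phi:\mathbb{D}\to\mathbb{D}$ is holomorphic with $\phi(\mathbb{D})=\mathbb{D}$) such that, for every $w\in\mathbb{D}$, the inner part of $\phi-w$ is a finite Blaschke product if and only if $w=0$.
   Context: $\mathbb{D}=\{z\in\mathbb{C}:|z|<1\}$ and $H^\infty(\mathbb{D})$ is the set of bounded holomorphic functions on $\mathbb{D}$. Every $f\in H^\infty(\mathbb{D})$ that is not identically zero has a factorization $f=SF$, unique up to unimodular constants, with $S$ inner (a bounded holomorphic function on $\mathbb{D}$ whose radial boundary values have modulus $1$ almost everywhere on the unit circle) and $F$ outer; $S$ is called the inner part of $f$. A finite Blaschke product is a function of the form $c\prod_{j=1}^{n}\frac{a_j-z}{1-\overline{a_j}z}$ with $|c|=1$ and $a_1,\dots,a_n\in\mathbb{D}$. *)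

theory Defs
  imports "HOL-Complex_Analysis.Complex_Analysis"
begin

abbreviation unit_disk :: "complex set" where
  "unit_disk \<equiv> ball 0 1"

text \<open>
  Functions on the disk are functions on all of \<^typ>\<open>complex\<close>; only their values on
  \<^const>\<open>unit_disk\<close> matter. The unit circle is parametrized by \<^term>\<open>cis t\<close>
  with \<open>t\<close> in \<open>[0, 2 pi]\<close>.
\<close>

definition hardy_inf :: "(complex \<Rightarrow> complex) set" where
  "hardy_inf = {f. f holomorphic_on unit_disk \<and> bounded (f ` unit_disk)}"

definition inner_function :: "(complex \<Rightarrow> complex) \<Rightarrow> bool" where
  "inner_function S \<longleftrightarrow> S \<in> hardy_inf \<and>
     (AE t\<in>{0..2 * pi} in lebesgue.
        \<exists>l. ((\<lambda>r. S (of_real r * cis t)) \<longlongrightarrow> l) (at_left (1::real)) \<and> cmod l = 1)"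

text \<open>
  \<open>k\<close> is the modulus of the boundary values of \<open>F\<close>; its measurability follows from that
  of \<open>ln k\<close>, since \<open>k\<close> is positive.
\<close>

definition outer_function :: "(complex \<Rightarrow> complex) \<Rightarrow> bool" where
  "outer_function F \<longleftrightarrow>
     (\<exists>(c::complex) (k::real \<Rightarrow> real). cmod c = 1 \<and>
        (\<forall>t\<in>{0..2 * pi}. k t > 0) \<and>
        set_integrable lebesgue {0..2 * pi} (\<lambda>t. ln (k t)) \<and>
        (\<forall>z\<in>unit_disk. F z = c * exp (1 / (2 * of_real pi) *
           (LINT t:{0..2 * pi}|lebesgue. (cis t + z) / (cis t - z) * of_real (ln (k t))))))"

text \<open>
  The inner part is determined only up to a unimodular constant, so it is a relation rather
  than a function: \<open>S\<close> is an inner part of \<open>f\<close>. For \<open>f\<close> in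
  \<^const>\<open>hardy_inf\<close> the outer factor is automatically bounded, because its boundary
  values have the same modulus as those of \<open>f\<close>.
\<close>

definition is_inner_part :: "(complex \<Rightarrow> complex) \<Rightarrow> (complex \<Rightarrow> complex) \<Rightarrow> bool" where
  "is_inner_part S f \<longleftrightarrow> inner_function S \<and>
     (\<exists>F. outer_function F \<and> (\<forall>z\<in>unit_disk. f z = S z * F z))"

definition finite_blaschke_product :: "(complex \<Rightarrow> complex) \<Rightarrow> bool" where
  "finite_blaschke_product B \<longleftrightarrow>
     (\<exists>(c::complex) (n::nat) (a::nat \<Rightarrow> complex). cmod c = 1 \<and> (\<forall>j\<in>{1..n}. a j \<in> unit_disk) \<and>
        (\<forall>z\<in>unit_disk. B z = c * (\<Prod>j=1..n. (a j - z) / (1 - cnj (a j) * z))))"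

end

theory Submission
  imports Defs
begin

text \<open>
  The witness is \<open>\<phi>(z) = z exp (-h(z))\<close> with \<open>h(z) = sqrt (\<i> / (1 - z))\<close>. The function \<open>h\<close>
  maps the disk into the first quadrant and grows only like \<open>|1 - z| powr (-1/2)\<close>, which is
  integrable on the circle; hence \<open>h\<close> is the Schwarz integral of its boundary values,
  \<open>exp (-h)\<close> is outer, and the identity is the inner part of \<open>\<phi>\<close>.

  In the coordinate \<open>u = h(z)\<close> one has \<open>\<phi> = (1 - \<i> / u\<^sup>2) exp (-u)\<close>, and the range of \<open>h\<close>
  contains neighbourhoods of fixed size of the points \<open>-Ln w + 2 \<pi> \<i> n\<close> for all large \<open>n\<close>. There
  \<open>\<phi>\<close> is close to \<open>exp (-u)\<close>, so by Hurwitz's theorem \<open>\<phi>\<close> takes each value \<open>w \<noteq> 0\<close> of the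
  disk infinitely often, whereas a finite Blaschke product times a zero-free outer function has
  only finitely many zeros.
\<close>

section \<open>The Schwarz integral formula, on the closed disk and then by passage to the
  boundary\<close>

lemma has_integral_circle_mean:
  assumes "g holomorphic_on cball 0 1"
  shows "((\<lambda>t. g (cis t)) has_integral 2 * of_real pi * g 0) {0..2 * pi}"
proof -
  have "((\<lambda>u. g u / (u - 0)) has_contour_integral (2 * of_real pi * \<i> * g 0)) (circlepath 0 1)"
    using assms by (intro Cauchy_integral_circlepath_simple) auto
  then have "((\<lambda>t. g (cis t) * \<i>) has_integral (2 * of_real pi * \<i> * g 0)) {0..2 * pi}"
    unfolding circlepath_def by (subst (asm) has_contour_integral_part_circlepath_iff) auto
  then have "((\<lambda>t. g (cis t) * \<i> * (1 / \<i>)) has_integral (2 * of_real pi * \<i> * g 0 * (1 / \<i>))) {0..2 * pi}"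
    by (rule has_integral_mult_left)
  then show ?thesis by (simp add: field_simps)
qed

text \<open>Cauchy's formula minus the mean value gives the Schwarz kernel against \<open>f\<close>.
  Against \<open>cnj f\<close> the integral is the conjugate of a mean value, because the conjugated
  kernel extends holomorphically to the closed disk. Averaging the two leaves the real part.\<close>

lemma has_integral_Schwarz_formula:
  assumes f: "f holomorphic_on cball 0 1" and z: "z \<in> ball 0 1"
  shows "((\<lambda>t. (cis t + z) / (cis t - z) * of_real (Re (f (cis t)))) has_integral
           2 * of_real pi * (f z - \<i> * of_real (Im (f 0)))) {0..2 * pi}"
proof -
  have ne: "cis t \<noteq> z" for t
    using z by (metis less_irrefl mem_ball_0 norm_cis)
  have "((\<lambda>u. f u / (u - z)) has_contour_integral (2 * of_real pi * \<i> * f z)) (circlepath 0 1)"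
    using assms by (intro Cauchy_integral_circlepath_simple) auto
  then have "((\<lambda>t. f (cis t) / (cis t - z) * \<i> * cis t) has_integral (2 * of_real pi * \<i> * f z)) {0..2 * pi}"
    unfolding circlepath_def by (subst (asm) has_contour_integral_part_circlepath_iff) auto
  from has_integral_mult_left[OF this, of "2 / \<i>"]
  have "((\<lambda>t. f (cis t) * (2 * cis t / (cis t - z))) has_integral (4 * of_real pi * f z)) {0..2 * pi}"
    by (simp add: field_simps)
  \<comment> \<open>The kernels combine by 2u/(u - z) - 1 = (u + z)/(u - z).\<close>
  from has_integral_diff[OF this has_integral_circle_mean[OF f]]
  have 1: "((\<lambda>t. (cis t + z) / (cis t - z) * f (cis t)) has_integral
             (4 * of_real pi * f z - 2 * of_real pi * f 0)) {0..2 * pi}"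
    by (rule has_integral_eq[rotated]) (use ne in \<open>simp add: field_simps\<close>)
  have nz: "1 - cnj z * u \<noteq> 0" if "u \<in> cball 0 1" for u
  proof
    assume "1 - cnj z * u = 0"
    then have "cmod (cnj z * u) = 1" by (metis eq_iff_diff_eq_0 norm_one)
    moreover have "cmod z * cmod u \<le> cmod z * 1"
      using that by (intro mult_left_mono) auto
    ultimately show False using z by (simp add: norm_mult)
  qed
  have "(\<lambda>u. (1 + cnj z * u) / (1 - cnj z * u) * f u) holomorphic_on cball 0 1"
    using nz f by (intro holomorphic_intros)
  from has_integral_linear[OF has_integral_circle_mean[OF this] bounded_linear_cnj]
  have "((\<lambda>t. cnj ((1 + cnj z * cis t) / (1 - cnj z * cis t) * f (cis t))) has_integral
     cnj (2 * of_real pi * ((1 + cnj z * 0) / (1 - cnj z * 0) * f 0))) {0..2 * pi}"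
    by (simp only: o_def)
  \<comment> \<open>On the circle \<open>cnj (cis t)\<close> equals \<open>1 / cis t\<close>, so
    conjugation recovers the Schwarz kernel.\<close>
  moreover have "cnj ((1 + cnj z * cis t) / (1 - cnj z * cis t)) = (cis t + z) / (cis t - z)" for t
  proof -
    have "cnj ((1 + cnj z * cis t) / (1 - cnj z * cis t)) = (1 + z / cis t) / (1 - z / cis t)"
      by (simp add: cis_cnj divide_inverse cis_inverse)
    also have "\<dots> = (cis t + z) / (cis t - z)"
      using ne[of t] by (simp add: divide_simps)
    finally show ?thesis .
  qed
  ultimately have 2: "((\<lambda>t. (cis t + z) / (cis t - z) * cnj (f (cis t))) has_integral
     2 * of_real pi * cnj (f 0)) {0..2 * pi}"
    by (simp only: complex_cnj_mult) simp
  have Re: "of_real (Re w) = (w + cnj w) / 2" and Im: "\<i> * of_real (Im w) = (w - cnj w) / 2" for w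
    by (simp_all add: complex_eq_iff)
  have "(4 * of_real pi * f z - 2 * of_real pi * f 0 + 2 * of_real pi * cnj (f 0)) * (1 / 2) =
          2 * of_real pi * (f z - \<i> * of_real (Im (f 0)))"
    unfolding Im by (simp add: field_simps)
  with has_integral_mult_left[OF has_integral_add[OF 1 2], of "1/2"]
  have "((\<lambda>t. ((cis t + z) / (cis t - z) * f (cis t) + (cis t + z) / (cis t - z) * cnj (f (cis t))) * (1 / 2))
           has_integral 2 * of_real pi * (f z - \<i> * of_real (Im (f 0)))) {0..2 * pi}"
    by metis
  then show ?thesis
    unfolding Re by (simp only: distrib_left[symmetric] mult.assoc) simp
qed

text \<open>The formula holds for every dilation f(r z) with r < 1, and dominated convergence lets r
  tend to 1. Bound and limit are asked for on the open interval only, so \<open>f\<close> may be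
  singular at the boundary point 1.\<close>

lemma Schwarz_formula_dominated:
  fixes u b :: "real \<Rightarrow> real"
  assumes f: "f holomorphic_on ball 0 1"
    and b: "b integrable_on {0..2 * pi}"
    and bound: "\<And>r t. \<lbrakk>0 < r; r < 1; t \<in> {0<..<2 * pi}\<rbrakk> \<Longrightarrow> \<bar>Re (f (of_real r * cis t))\<bar> \<le> b t"
    and lim: "\<And>t. t \<in> {0<..<2 * pi} \<Longrightarrow> ((\<lambda>r. Re (f (of_real r * cis t))) \<longlongrightarrow> u t) (at_left 1)"
    and z: "z \<in> ball 0 1"
  shows "set_integrable lebesgue {0..2 * pi} (\<lambda>t. (cis t + z) / (cis t - z) * of_real (u t))"
    and "(LINT t:{0..2 * pi}|lebesgue. (cis t + z) / (cis t - z) * of_real (u t)) =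
           2 * of_real pi * (f z - \<i> * of_real (Im (f 0)))"
proof -
  define r :: "nat \<Rightarrow> real" where "r n = 1 - 1 / (real n + 2)" for n
  have r: "0 < r n" "r n < 1" for n by (simp_all add: r_def field_simps)
  have "r \<longlonglongrightarrow> 1" unfolding r_def by real_asymp
  then have r1: "filterlim r (at_left 1) sequentially"
    using r by (intro tendsto_imp_filterlim_at_left) auto
  \<comment> \<open>\<open>C\<close> bounds the Schwarz kernel for all t, so \<open>C * b t\<close>
    is the dominating function.\<close>
  define C where "C = (1 + cmod z) / (1 - cmod z)"
  have C: "cmod ((cis t + z) / (cis t - z)) \<le> C" for t
    unfolding C_def norm_divide
    using z norm_triangle_ineq[of "cis t" z] norm_triangle_ineq2[of "cis t" z]
    by (intro frac_le) auto
  have C0: "C \<ge> 0" using z by (simp add: C_def)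
  have b': "(\<lambda>t. C * b t) integrable_on {0<..<2 * pi}"
    using b by (simp add: integrable_on_mult_right flip: integrable_on_Icc_iff_Ioo)
  have K: "cmod ((cis t + z) / (cis t - z) * of_real x) \<le> C * b t" if "\<bar>x\<bar> \<le> b t" for x t
    unfolding norm_mult using C[of t] that C0 by (intro mult_mono) auto
  have ulim: "(\<lambda>n. Re (f (of_real (r n) * cis t))) \<longlonglongrightarrow> u t" if "t \<in> {0<..<2 * pi}" for t
    using filterlim_compose[OF lim[OF that] r1] .
  have Ioo: "((\<lambda>t. (cis t + z) / (cis t - z) * of_real (u t)) has_integral
           2 * of_real pi * (f z - \<i> * of_real (Im (f 0)))) {0<..<2 * pi}"
  proof (rule has_integral_dominated_convergence[OF _ b'])
    fix n
    have "((\<lambda>t. (cis t + z) / (cis t - z) * of_real (Re (f (of_real (r n) * cis t)))) has_integral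
           2 * of_real pi * (f (of_real (r n) * z) - \<i> * of_real (Im (f (of_real (r n) * 0))))) {0..2 * pi}"
    proof (rule has_integral_Schwarz_formula[OF _ z])
      have "cmod (of_real (r n) * u) < 1" if "cmod u \<le> 1" for u
        using le_less_trans[OF mult_left_mono[OF that, of "r n"], of 1] r[of n] by (simp add: norm_mult)
      then show "(\<lambda>u. f (of_real (r n) * u)) holomorphic_on cball 0 1"
        using holomorphic_on_compose_gen[OF _ f, of "\<lambda>u. of_real (r n) * u" "cball 0 1"]
        by (force simp: o_def intro!: holomorphic_intros)
    qed
    then show "((\<lambda>t. (cis t + z) / (cis t - z) * of_real (Re (f (of_real (r n) * cis t)))) has_integral
           2 * of_real pi * (f (of_real (r n) * z) - \<i> * of_real (Im (f 0)))) {0<..<2 * pi}"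
      by (simp add: has_integral_Icc_iff_Ioo)
    show "\<forall>t\<in>{0<..<2 * pi}. cmod ((cis t + z) / (cis t - z) *
         of_real (Re (f (of_real (r n) * cis t)))) \<le> C * b t"
      using bound r K by blast
  next
    show "\<forall>t\<in>{0<..<2 * pi}. (\<lambda>n. (cis t + z) / (cis t - z) *
         of_real (Re (f (of_real (r n) * cis t)))) \<longlonglongrightarrow> (cis t + z) / (cis t - z) * of_real (u t)"
      using ulim by (intro ballI tendsto_intros) auto
    have "isCont f z"
      using f z by (meson continuous_on_eq_continuous_at holomorphic_on_imp_continuous_on open_ball)
    moreover have "(\<lambda>n. of_real (r n) * z) \<longlonglongrightarrow> of_real 1 * z"
      using \<open>r \<longlonglongrightarrow> 1\<close> by (intro tendsto_intros)
    ultimately have "(\<lambda>n. f (of_real (r n) * z)) \<longlonglongrightarrow> f z"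
      using isCont_tendsto_compose[of z f] by simp
    then show "(\<lambda>n. 2 * of_real pi * (f (of_real (r n) * z) - \<i> * of_real (Im (f 0))))
       \<longlonglongrightarrow> 2 * of_real pi * (f z - \<i> * of_real (Im (f 0)))"
      by (intro tendsto_intros)
  qed
  \<comment> \<open>The limit \<open>u\<close> inherits the bound \<open>b\<close>; this upgrades
    gauge integrability to the absolute integrability behind the Lebesgue integral.\<close>
  have "(\<lambda>t. (cis t + z) / (cis t - z) * of_real (u t)) absolutely_integrable_on {0<..<2 * pi}"
  proof (rule absolutely_integrable_integrable_bound[OF _ _ b'])
    fix t :: real assume t: "t \<in> {0<..<2 * pi}"
    have "\<bar>u t\<bar> \<le> b t"
      by (rule LIMSEQ_le_const2[OF tendsto_rabs[OF ulim[OF t]]]) (use bound r t in blast)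
    then show "cmod ((cis t + z) / (cis t - z) * of_real (u t)) \<le> C * b t" by (rule K)
  qed (use Ioo in blast)
  then show int: "set_integrable lebesgue {0..2 * pi} (\<lambda>t. (cis t + z) / (cis t - z) * of_real (u t))"
    by (simp only: absolutely_integrable_on_open_interval[of 0 "2 * pi", unfolded box_real])
  show "(LINT t:{0..2 * pi}|lebesgue. (cis t + z) / (cis t - z) * of_real (u t)) =
           2 * of_real pi * (f z - \<i> * of_real (Im (f 0)))"
    unfolding set_lebesgue_integral_eq_integral(2)[OF int]
    by (rule integral_unique) (use Ioo in \<open>simp only: has_integral_Icc_iff_Ioo\<close>)
qed

section \<open>An integrable bound near the boundary point 1\<close>

text \<open>Jordan's inequality: sine is concave on [0, pi/2] and so lies above its chord.\<close>

lemma sin_half_ge: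
  assumes "0 \<le> t" "t \<le> pi"
  shows "t / pi \<le> sin (t / 2)"
proof -
  have "convex_on {0..pi/2} (\<lambda>x. - sin x)"
    by (rule f''_ge0_imp_convex[where f' = "\<lambda>x. - cos x" and f'' = sin])
       (auto intro!: derivative_eq_intros sin_ge_zero)
  from convex_onD_Icc'[OF this, of "t / 2"] assms show ?thesis
    by simp
qed

lemma cmod_one_minus_cis: "cmod (1 - cis t) = 2 * \<bar>sin (t / 2)\<bar>"
  using dist_exp_i_1[of t] by (simp add: cis_conv_exp norm_minus_commute)

text \<open>Both ends of the interval represent the point 1. Jordan's inequality covers the half
  next to 0, and the reflection of t to 2 pi - t covers the other.\<close>

lemma inverse_sqrt_cmod_one_minus_cis_le:
  assumes t: "t \<in> {0<..<2 * pi}"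
  shows "1 / sqrt (cmod (1 - cis t)) \<le> 2 * (t powr (-1/2) + (2 * pi - t) powr (-1/2))"
proof -
  have *: "1 / sqrt (cmod (1 - cis s)) \<le> 2 * s powr (-1/2)" if "0 < s" "s \<le> pi" for s
  proof -
    \<comment> \<open>The crude constant 1/4 has the square root 1/2, whence the factor 2 in the
      bound.\<close>
    have "s / 4 \<le> s / pi * 2"
      using that pi_less_4 by (simp add: field_simps)
    also have "\<dots> \<le> cmod (1 - cis s)"
      using mult_right_mono[OF sin_half_ge[of s], of 2] that
      unfolding cmod_one_minus_cis by linarith
    finally have "sqrt (s / 4) \<le> sqrt (cmod (1 - cis s))" by simp
    moreover have "0 < sqrt (s / 4)" using that by simp
    ultimately have "1 / sqrt (cmod (1 - cis s)) \<le> 1 / sqrt (s / 4)"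
      by (intro divide_left_mono mult_pos_pos) auto
    also have "\<dots> = 2 * s powr (-1/2)"
      using that by (simp add: real_sqrt_divide powr_minus powr_half_sqrt field_simps)
    finally show ?thesis .
  qed
  show ?thesis
  proof (cases "t \<le> pi")
    case True
    then show ?thesis using *[of t] t by (smt (verit) greaterThanLessThan_iff powr_ge_zero)
  next
    case False
    have "cmod (1 - cis (2 * pi - t)) = cmod (1 - cis t)"
    proof -
      have "sin ((2 * pi - t) / 2) = sin (t / 2)"
        by (simp add: diff_divide_distrib)
      then show ?thesis by (simp add: cmod_one_minus_cis)
    qed
    then show ?thesis using *[of "2 * pi - t"] t False by (smt (verit) greaterThanLessThan_iff powr_ge_zero)
  qed
qed

lemma integrable_endpoint_powr:
  "(\<lambda>t. t powr (-1/2) + (a - t) powr (-1/2)) integrable_on {0..a::real}"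
proof (cases "a \<ge> 0")
  case True
  have 1: "(\<lambda>t. t powr (-1/2)) integrable_on {0..a}"
    using True by (intro integrable_on_powr_from_0) auto
  have "(\<lambda>t. (a - t) powr (-1/2)) integrable_on {0..a}"
    using integrable_affinity[of "\<lambda>t. t powr (-1/2)" 0 a "-1" a] 1 True by simp
  with 1 show ?thesis by (rule integrable_add)
qed auto

section \<open>The map \<open>h\<close> into the first quadrant and its inverse\<close>

text \<open>For Re z < 1 the radicand lies in the upper half-plane, away from the branch cut. This
  half-plane contains the circle without 1, so boundary values there are ordinary values.\<close>

definition quadrant_map :: "complex \<Rightarrow> complex" where
  "quadrant_map z = csqrt (\<i> / (1 - z))"

lemma Im_i_divide_pos:
  assumes "Re z < 1"
  shows "0 < Im (\<i> / (1 - z))"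
  using assms by (simp add: Im_divide add_pos_nonneg)

lemma Re_less_1: "cmod z \<le> 1 \<Longrightarrow> z \<noteq> 1 \<Longrightarrow> Re z < 1"
  using complex_Re_le_cmod[of z] cmod_power2[of z] abs_square_le_1[of "cmod z"]
  by (cases "Re z = 1") (auto simp: cmod_power2 complex_eq_iff)

lemma i_divide_notin_nonpos_Reals: "Re z < 1 \<Longrightarrow> \<i> / (1 - z) \<notin> \<real>\<^sub>\<le>\<^sub>0"
  using Im_i_divide_pos[of z] by (auto simp: complex_nonpos_Reals_iff)

lemma Re_quadrant_map_pos:
  assumes "Re z < 1"
  shows "0 < Re (quadrant_map z)"
proof (rule ccontr)
  assume "\<not> 0 < Re (quadrant_map z)"
  then have "Re (quadrant_map z) = 0"
    using csqrt_principal unfolding quadrant_map_def by blast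
  then have "Im ((quadrant_map z)\<^sup>2) = 0" by (simp add: power2_eq_square)
  then show False
    using Im_i_divide_pos[OF assms] by (simp add: quadrant_map_def del: csqrt.sel)
qed

lemma cmod_quadrant_map: "cmod (quadrant_map z) = 1 / sqrt (cmod (1 - z))"
  by (simp add: quadrant_map_def norm_divide real_sqrt_divide)

lemma holomorphic_on_quadrant_map: "quadrant_map holomorphic_on {z. Re z < 1}"
  unfolding quadrant_map_def
  by (intro holomorphic_intros i_divide_notin_nonpos_Reals) auto

lemma holomorphic_on_quadrant_map_ball: "quadrant_map holomorphic_on ball 0 1"
  by (rule holomorphic_on_subset[OF holomorphic_on_quadrant_map]) (auto intro: le_less_trans[OF complex_Re_le_cmod])

lemma cmod_exp_quadrant_map: "Re z < 1 \<Longrightarrow> cmod (exp (- quadrant_map z)) < 1"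
  using Re_quadrant_map_pos[of z] by simp

text \<open>Solving u^2 = i/(1 - z) gives z = 1 - i/u^2. This z lies in the disk exactly when u^2 is
  nearer to i than to 0, that is, when Im (u^2) > 1/2; Re u > 0 selects the principal root.\<close>

lemma quadrant_map_inverse:
  assumes "0 < Re u" "1 / 2 < Im (u\<^sup>2)"
  shows "cmod (1 - \<i> / u\<^sup>2) < 1" "quadrant_map (1 - \<i> / u\<^sup>2) = u"
proof -
  have ne: "u\<^sup>2 \<noteq> 0" using assms by auto
  have "(cmod (u\<^sup>2 - \<i>))\<^sup>2 < (cmod (u\<^sup>2))\<^sup>2"
    unfolding cmod_power2 using assms(2) by (simp add: power2_diff)
  then have "cmod (u\<^sup>2 - \<i>) < cmod (u\<^sup>2)"
    by (meson norm_ge_zero power2_less_imp_less)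
  moreover have "1 - \<i> / u\<^sup>2 = (u\<^sup>2 - \<i>) / u\<^sup>2"
    using ne by (simp add: field_simps)
  ultimately show "cmod (1 - \<i> / u\<^sup>2) < 1"
    using ne by (simp only: norm_divide) (simp add: field_simps)
  show "quadrant_map (1 - \<i> / u\<^sup>2) = u"
    using assms by (simp add: quadrant_map_def csqrt_square)
qed

section \<open>Outerness of exp (-h)\<close>

lemma cis_ne_1: "t \<in> {0<..<2 * pi} \<Longrightarrow> cis t \<noteq> 1"
  using cmod_one_minus_cis[of t] sin_gt_zero[of "t / 2"] by auto

text \<open>The radial step from r w to w has length 1 - r, which is itself at most |1 - r w|. Hence
  a bound on the circle controls all radii at once.\<close>

lemma cmod_one_minus_scaled_ge:
  assumes "0 \<le> r" "r \<le> 1" "cmod w = 1"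
  shows "cmod (1 - w) \<le> 2 * cmod (1 - of_real r * w)"
proof -
  have "1 - r \<le> cmod (1 - of_real r * w)"
    using norm_triangle_ineq2[of 1 "of_real r * w"] assms by (simp add: norm_mult)
  moreover have "cmod ((1 - of_real r * w) - of_real (1 - r) * w) \<le> cmod (1 - of_real r * w) + (1 - r)"
    using norm_triangle_ineq4[of "1 - of_real r * w" "of_real (1 - r) * w"] assms
    by (simp add: norm_mult del: of_real_diff)
  moreover have "(1 - of_real r * w) - of_real (1 - r) * w = 1 - w"
    by (simp add: algebra_simps)
  ultimately have "cmod (1 - w) \<le> cmod (1 - of_real r * w) + (1 - r)"
    by (simp only:)
  with \<open>1 - r \<le> cmod (1 - of_real r * w)\<close> show ?thesis by linarith
qed

lemma outer_function_exp_quadrant_map: "outer_function (\<lambda>z. exp (- quadrant_map z))"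
proof -
  define b where "b t = 4 * (t powr (-1/2) + (2 * pi - t) powr (-1/2))" for t :: real
  \<comment> \<open>At both endpoints the argument is 1, where division by zero makes
    \<open>u\<close> equal to 0.\<close>
  define u where "u t = - Re (quadrant_map (cis t))" for t
  have b: "b integrable_on {0..2 * pi}"
    unfolding b_def by (intro integrable_on_mult_right integrable_endpoint_powr)
  have bound: "\<bar>Re (- quadrant_map (of_real r * cis t))\<bar> \<le> b t"
    if "0 < r" "r < 1" "t \<in> {0<..<2 * pi}" for r t
  proof -
    have pos: "0 < cmod (1 - cis t)" using cis_ne_1[OF that(3)] by simp
    \<comment> \<open>The factor 2 is relaxed to 4 so that its square root is rational.\<close>
    have "cmod (1 - cis t) \<le> 4 * cmod (1 - of_real r * cis t)"
      using cmod_one_minus_scaled_ge[of r "cis t"] that norm_ge_zero[of "1 - of_real r * cis t"]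
      unfolding greaterThanLessThan_iff norm_cis by linarith
    then have le: "sqrt (cmod (1 - cis t)) \<le> 2 * sqrt (cmod (1 - of_real r * cis t))"
      by (drule_tac real_sqrt_le_mono) (simp add: real_sqrt_mult)
    have "\<bar>Re (- quadrant_map (of_real r * cis t))\<bar> \<le> cmod (quadrant_map (of_real r * cis t))"
      by (metis abs_Re_le_cmod norm_minus_cancel)
    also have "\<dots> \<le> 2 * (1 / sqrt (cmod (1 - cis t)))"
    proof -
      have "0 < sqrt (cmod (1 - cis t))" using pos by simp
      moreover from this le have "0 < sqrt (cmod (1 - of_real r * cis t))" by linarith
      ultimately show ?thesis unfolding cmod_quadrant_map using le by (simp add: field_simps)
    qed
    also have "\<dots> \<le> b t"
      using inverse_sqrt_cmod_one_minus_cis_le[OF that(3)] by (simp add: b_def)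
    finally show ?thesis .
  qed
  have lim: "((\<lambda>r. Re (- quadrant_map (of_real r * cis t))) \<longlongrightarrow> u t) (at_left 1)"
    if t: "t \<in> {0<..<2 * pi}" for t
  proof -
    have "Re (cis t) < 1" using cis_ne_1[OF t] by (intro Re_less_1) auto
    then have "isCont quadrant_map (of_real 1 * cis t)"
      using holomorphic_on_imp_continuous_on[OF holomorphic_on_quadrant_map]
      by (simp add: continuous_on_eq_continuous_at open_halfspace_Re_lt)
    moreover have "((\<lambda>r. of_real r * cis t) \<longlongrightarrow> of_real 1 * cis t) (at_left (1::real))"
      by (intro tendsto_intros)
    ultimately have "((\<lambda>r. quadrant_map (of_real r * cis t)) \<longlongrightarrow> quadrant_map (of_real 1 * cis t)) (at_left 1)"
      by (rule isCont_tendsto_compose)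
    then show ?thesis unfolding u_def by (auto intro!: tendsto_intros)
  qed
  have hol: "(\<lambda>z. - quadrant_map z) holomorphic_on ball 0 1"
    by (intro holomorphic_intros holomorphic_on_quadrant_map_ball)
  have Schwarz:
    "set_integrable lebesgue {0..2 * pi} (\<lambda>t. (cis t + z) / (cis t - z) * of_real (u t))"
    "(LINT t:{0..2 * pi}|lebesgue. (cis t + z) / (cis t - z) * of_real (u t)) =
       2 * of_real pi * (- quadrant_map z - \<i> * of_real (Im (- quadrant_map 0)))"
    if "z \<in> ball 0 1" for z
    by (rule Schwarz_formula_dominated[OF hol b bound lim that]; assumption)+
  \<comment> \<open>At z = 0 the kernel is 1.\<close>
  have "set_integrable lebesgue {0..2 * pi} (\<lambda>t. complex_of_real (u t))"
    using Schwarz(1)[of 0] by simp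
  then have int: "set_integrable lebesgue {0..2 * pi} u"
    unfolding set_integrable_def by (auto dest: integrable_Re)
  show ?thesis
    unfolding outer_function_def
  \<comment> \<open>The Schwarz integral recovers -h up to an imaginary constant, which the
    unimodular factor absorbs.\<close>
  proof (intro exI[of _ "exp (- \<i> * of_real (Im (quadrant_map 0)))"] exI[of _ "\<lambda>t. exp (u t)"] conjI ballI)
    show "exp (- quadrant_map z) = exp (- \<i> * of_real (Im (quadrant_map 0))) * exp (1 / (2 * of_real pi) *
        (LINT t:{0..2 * pi}|lebesgue. (cis t + z) / (cis t - z) * of_real (ln (exp (u t)))))"
      if "z \<in> unit_disk" for z
      unfolding ln_exp Schwarz(2)[OF that] by (simp flip: exp_add)
  qed (use int in \<open>auto simp: norm_exp_i_times\<close>)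
qed

section \<open>Inner parts that are finite Blaschke products\<close>

lemma inner_function_id: "inner_function (\<lambda>z. z)"
proof -
  have "((\<lambda>r. of_real r * cis t) \<longlongrightarrow> of_real 1 * cis t) (at_left (1::real))" for t
    by (intro tendsto_intros)
  then have "\<exists>l. ((\<lambda>r. of_real r * cis t) \<longlongrightarrow> l) (at_left (1::real)) \<and> cmod l = 1" for t
    by (metis mult_1 norm_cis of_real_1)
  then show ?thesis
    unfolding inner_function_def hardy_inf_def by simp
qed

lemma finite_blaschke_product_id: "finite_blaschke_product (\<lambda>z. z)"
  unfolding finite_blaschke_product_def
  \<comment> \<open>The Blaschke factor for a = 0 is -z, hence the constant -1.\<close>
  by (rule exI[of _ "-1"], rule exI[of _ 1], rule exI[of _ "\<lambda>_. 0"]) auto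

text \<open>An outer function is a nonzero multiple of an exponential, so every zero comes from the
  Blaschke product.\<close>

lemma finite_zeros_if_finite_blaschke_inner_part:
  assumes "is_inner_part S f" "finite_blaschke_product S"
  shows "finite {z \<in> unit_disk. f z = 0}"
proof -
  obtain F where F: "outer_function F" "\<And>z. z \<in> unit_disk \<Longrightarrow> f z = S z * F z"
    using assms(1) unfolding is_inner_part_def by blast
  have F0: "F z \<noteq> 0" if "z \<in> unit_disk" for z
    using F(1) that unfolding outer_function_def by force
  obtain c :: complex and n :: nat and a :: "nat \<Rightarrow> complex" where S: "cmod c = 1" "\<And>j. j \<in> {1..n} \<Longrightarrow> a j \<in> unit_disk"
    "\<And>z. z \<in> unit_disk \<Longrightarrow> S z = c * (\<Prod>j=1..n. (a j - z) / (1 - cnj (a j) * z))"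
    using assms(2) unfolding finite_blaschke_product_def by blast
  have "z \<in> a ` {1..n}" if z: "z \<in> unit_disk" "f z = 0" for z
  proof -
    have "(\<Prod>j=1..n. (a j - z) / (1 - cnj (a j) * z)) = 0"
      using F(2)[OF z(1)] F0[OF z(1)] S(1) S(3)[OF z(1)] z(2) by auto
    \<comment> \<open>A quotient also vanishes when its denominator is 0; that case is excluded
      next.\<close>
    then obtain j where j: "j \<in> {1..n}" "a j - z = 0 \<or> 1 - cnj (a j) * z = 0"
      by auto
    have "cmod (cnj (a j) * z) < 1 * 1"
      unfolding norm_mult using S(2)[OF j(1)] z(1) by (intro mult_strict_mono') auto
    then have "1 - cnj (a j) * z \<noteq> 0"
      by (metis eq_iff_diff_eq_0 less_irrefl mult_1 norm_one)
    then show ?thesis using j by auto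
  qed
  then have "{z \<in> unit_disk. f z = 0} \<subseteq> a ` {1..n}" by blast
  then show ?thesis by (rule finite_subset) simp
qed

section \<open>Infinite fibres over nonzero values, and the conclusion\<close>

text \<open>On a finite fibre Im h is bounded. Translates of a fixed ball lying above that bound
  then carry no solutions, and Hurwitz's theorem passes this to the limit exp (-v) - w, which does
  vanish at \<open>v0\<close>.\<close>

lemma infinite_fibre:
  assumes w: "w \<in> unit_disk" "w \<noteq> 0"
  shows "infinite {z \<in> unit_disk. z * exp (- quadrant_map z) = w}" (is "infinite ?Z")
proof
  assume fin: "finite ?Z"
  define v0 where "v0 = - Ln w"
  \<comment> \<open>Since |w| < 1, Re \<open>v0\<close> = -ln |w| is positive; half of it keeps the
    ball inside Re v > \<open>\<rho>\<close>.\<close>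
  define \<rho> where "\<rho> = Re v0 / 2"
  have \<rho>: "\<rho> > 0" "Re v0 = 2 * \<rho>" using w by (simp_all add: \<rho>_def v0_def)
  have v0: "exp (- v0) = w" using w by (simp add: v0_def)
  obtain M where M: "\<And>z. z \<in> ?Z \<Longrightarrow> Im (quadrant_map z) \<le> M"
    using bdd_above_finite[OF finite_imageI[OF fin, of "\<lambda>z. Im (quadrant_map z)"]]
    unfolding bdd_above_def by (metis (no_types, lifting) imageI)
  \<comment> \<open>Above height \<open>B\<close> a point is beyond the fibre, is nonzero, and
    satisfies Im (u^2) = 2 Re u Im u > 1/2.\<close>
  define B where "B = max (max M 1) (1 / (2 * \<rho>))"
  obtain N :: nat where N: "real N > B - Im v0 + \<rho>"
    using reals_Archimedean2 by blast
  \<comment> \<open>Shifts by multiples of 2 pi i preserve exp (-u); the offset \<open>N\<close>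
    puts even the case n = 0 above \<open>B\<close>.\<close>
  define u where "u n v = v + of_real (2 * pi * real (n + N)) * \<i>" for n v
  have Re_v: "Re v > \<rho>" and Im_u: "Im (u n v) > real n + B" if "v \<in> ball v0 \<rho>" for n v
  proof -
    have "\<bar>Re (v0 - v)\<bar> < \<rho>" "\<bar>Im (v0 - v)\<bar> < \<rho>"
      using that abs_Re_le_cmod[of "v0 - v"] abs_Im_le_cmod[of "v0 - v"] by (auto simp: dist_norm)
    then show "Re v > \<rho>" using \<rho> by simp
    have "real (n + N) * 1 \<le> real (n + N) * (2 * pi)"
      using pi_gt3 by (intro mult_left_mono) auto
    then show "Im (u n v) > real n + B"
      using \<open>\<bar>Im (v0 - v)\<bar> < \<rho>\<close> N unfolding u_def by (simp add: algebra_simps)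
  qed
  have Re_u: "Re (u n v) = Re v" and exp_u: "exp (- u n v) = exp (- v)" for n v
  proof -
    show "Re (u n v) = Re v" by (simp add: u_def)
    have "exp (- u n v) = exp (- v) * exp (of_int (- 2 * int (n + N)) * of_real pi * \<i>)"
      by (simp add: u_def algebra_simps flip: exp_add)
    also have "exp (of_int (- 2 * int (n + N)) * of_real pi * \<i>) = 1"
      by (subst exp_eq_1) (auto intro!: exI[of _ "- int (n + N)"])
    finally show "exp (- u n v) = exp (- v)" by simp
  qed
  have B: "B \<ge> 1" "B \<ge> M" "2 * \<rho> * B \<ge> 1"
  proof -
    show "B \<ge> 1" "B \<ge> M" by (auto simp: B_def)
    have "1 / (2 * \<rho>) \<le> B" by (simp add: B_def)
    then show "2 * \<rho> * B \<ge> 1" using \<rho> by (simp add: field_simps)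
  qed
  have u0: "u n v \<noteq> 0" if "v \<in> ball v0 \<rho>" for n v
    using Im_u[OF that, of n] B by auto
  have "exp (- v0) - w \<noteq> 0"
  proof (rule Hurwitz_no_zeros[where S = "ball v0 \<rho>" and g = "\<lambda>v. exp (- v) - w"
      and \<F> = "\<lambda>n v. (1 - \<i> / (u n v)\<^sup>2) * exp (- v) - w"])
    show "(\<lambda>v. (1 - \<i> / (u n v)\<^sup>2) * exp (- v) - w) holomorphic_on ball v0 \<rho>" for n
      using u0[of _ n] unfolding u_def by (intro holomorphic_intros) auto
    \<comment> \<open>The error is |exp (-v)| / |u|^2, at most 1/(n + 1) on the whole ball because
      |u| >= n + 1 and Re v > 0.\<close>
    show "uniform_limit K (\<lambda>n v. (1 - \<i> / (u n v)\<^sup>2) * exp (- v) - w) (\<lambda>v. exp (- v) - w) sequentially"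
      if "K \<subseteq> ball v0 \<rho>" for K
    proof (rule uniform_limit_on_subset[OF _ that], rule uniform_limitI)
      fix e :: real assume "e > 0"
      then have "\<forall>\<^sub>F n in sequentially. 1 / (real n + 1) < e"
        by real_asymp
      then show "\<forall>\<^sub>F n in sequentially. \<forall>v\<in>ball v0 \<rho>.
          dist ((1 - \<i> / (u n v)\<^sup>2) * exp (- v) - w) (exp (- v) - w) < e"
      proof eventually_elim
        case (elim n)
        show ?case
        proof
          fix v assume v: "v \<in> ball v0 \<rho>"
          have "real n + 1 \<le> cmod (u n v)"
            using Im_u[OF v, of n] B abs_Im_le_cmod[of "u n v"] by linarith
          then have ge: "real n + 1 \<le> (cmod (u n v))\<^sup>2"
            by (smt (verit) of_nat_0_le_iff power2_eq_square mult_le_cancel_left1)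
          have "dist ((1 - \<i> / (u n v)\<^sup>2) * exp (- v) - w) (exp (- v) - w) =
                  cmod (- (\<i> / (u n v)\<^sup>2 * exp (- v)))"
            unfolding dist_norm by (simp add: algebra_simps)
          also have "\<dots> = 1 / (cmod (u n v))\<^sup>2 * exp (- Re v)"
            by (simp add: norm_mult norm_divide norm_power)
          also have "\<dots> \<le> 1 / (real n + 1) * 1"
            using ge Re_v[OF v] \<rho> by (intro mult_mono frac_le) auto
          finally show "dist ((1 - \<i> / (u n v)\<^sup>2) * exp (- v) - w) (exp (- v) - w) < e"
            using elim by simp
        qed
      qed
    qed
    show "\<not> (\<lambda>v. exp (- v) - w) constant_on ball v0 \<rho>"
    proof
      assume "(\<lambda>v. exp (- v) - w) constant_on ball v0 \<rho>"
      moreover have "v0 \<in> ball v0 \<rho>" "v0 - of_real (\<rho> / 2) \<in> ball v0 \<rho>"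
        using \<rho> by (auto simp: dist_norm)
      ultimately have "cmod (exp (- v0)) = cmod (exp (- (v0 - of_real (\<rho> / 2))))"
        unfolding constant_on_def by (metis diff_add_cancel)
      then show False using \<rho> by simp
    qed
    \<comment> \<open>A zero would yield a point of the fibre whose image under h is
      \<open>u n v\<close>, with imaginary part above \<open>M\<close>.\<close>
    show "(1 - \<i> / (u n v)\<^sup>2) * exp (- v) - w \<noteq> 0" if v: "v \<in> ball v0 \<rho>" for n v
    proof
      assume eq: "(1 - \<i> / (u n v)\<^sup>2) * exp (- v) - w = 0"
      have pos: "0 < Re (u n v)" using Re_u Re_v[OF v] \<rho> by simp
      have "\<rho> * B < Re (u n v) * Im (u n v)"
        using Re_u Re_v[OF v] Im_u[OF v, of n] \<rho> B by (intro mult_strict_mono) auto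
      then have "1 / 2 < Im ((u n v)\<^sup>2)"
        using B by (simp add: Im_power2)
      note inv = quadrant_map_inverse[OF pos this]
      have "1 - \<i> / (u n v)\<^sup>2 \<in> ?Z"
        using inv eq by (simp add: exp_u)
      from M[OF this] show False
        using inv(2) Im_u[OF v, of n] B by simp
    qed
  qed (use \<rho> in \<open>auto intro!: holomorphic_intros\<close>)
  then show False using v0 by simp
qed

theorem theorem2p2:
  "\<exists>\<phi>::complex \<Rightarrow> complex. \<phi> holomorphic_on unit_disk \<and> \<phi> ` unit_disk = unit_disk \<and>
     (\<forall>w\<in>unit_disk.
        (\<exists>S. is_inner_part S (\<lambda>z. \<phi> z - w) \<and> finite_blaschke_product S) \<longleftrightarrow> w = 0)"
proof (intro exI[of _ "\<lambda>z. z * exp (- quadrant_map z)"] conjI ballI)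
  show "(\<lambda>z. z * exp (- quadrant_map z)) holomorphic_on unit_disk"
    by (intro holomorphic_intros holomorphic_on_quadrant_map_ball)
  show "(\<lambda>z. z * exp (- quadrant_map z)) ` unit_disk = unit_disk"
  proof (intro equalityI subsetI)
    fix w assume "w \<in> (\<lambda>z. z * exp (- quadrant_map z)) ` unit_disk"
    then obtain z where z: "cmod z < 1" "w = z * exp (- quadrant_map z)" by auto
    have "cmod (exp (- quadrant_map z)) < 1"
      using complex_Re_le_cmod[of z] z(1) by (intro cmod_exp_quadrant_map) linarith
    then have "cmod z * cmod (exp (- quadrant_map z)) < 1 * 1"
      using z(1) by (intro mult_strict_mono') auto
    then show "w \<in> unit_disk" unfolding z(2) by (simp add: norm_mult)
  next
    \<comment> \<open>Surjectivity: 0 is the image of 0, and an infinite fibre is nonempty.\<close>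
    fix w :: complex assume w: "w \<in> unit_disk"
    show "w \<in> (\<lambda>z. z * exp (- quadrant_map z)) ` unit_disk"
    proof (cases "w = 0")
      case True
      then show ?thesis by (intro image_eqI[of _ _ 0]) auto
    next
      case False
      then show ?thesis using infinite_imp_nonempty[OF infinite_fibre[OF w]] by blast
    qed
  qed
  fix w :: complex assume w: "w \<in> unit_disk"
  show "(\<exists>S. is_inner_part S (\<lambda>z. z * exp (- quadrant_map z) - w) \<and> finite_blaschke_product S) \<longleftrightarrow> w = 0"
  proof
    assume "\<exists>S. is_inner_part S (\<lambda>z. z * exp (- quadrant_map z) - w) \<and> finite_blaschke_product S"
    then have "finite {z \<in> unit_disk. z * exp (- quadrant_map z) - w = 0}"
      using finite_zeros_if_finite_blaschke_inner_part by blast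
    then show "w = 0" using infinite_fibre[OF w] by auto
  next
    assume "w = 0"
    then have "is_inner_part (\<lambda>z. z) (\<lambda>z. z * exp (- quadrant_map z) - w)"
      unfolding is_inner_part_def using inner_function_id outer_function_exp_quadrant_map by auto
    then show "\<exists>S. is_inner_part S (\<lambda>z. z * exp (- quadrant_map z) - w) \<and> finite_blaschke_product S"
      using finite_blaschke_product_id by blast
  qed
qed

end
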